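(* Let $A$ be a row-stochastic matrix of size $n>0$ and let $\mathcal{E}$ be a diagonal nonnegative matrix of size $n$. Suppose that $0\le\mathcal{E}(i)\le 2A(i,i)$ for all $i\in\{1,\dots,n\}$. Let $\bar\sigma=\sigma\mathbf{1}\in\mathbb{R}^n$ for some $\sigma\in\mathbb{R}$, let $X_0\in\mathbb{R}^n$, and let $X_{t+1}=AX_t+\mathcal{E}(\bar\sigma-X_t)$ for all integers $t\ge0$. If $A-\mathcal{E}$ is condensely anchored, then all agents eventually reach consensus, i.e. $\lim_{t\to\infty}X_t=\bar\sigma$.
   Context: All matrices are real square matrices. A nonnegative matrix is row stochastic if each row-sum equals $1$. $\mathbf{1}$ is the all-ones vector in $\mathbb{R}^n$, and $\mathcal{E}(i)$ is the $i$-th diagonal entry of the diagonal matrix $\mathcal{E}$. The underlying digraph $G[M]$ of a matrix $M$ of size $n$ has vertex set $\{1,\dots,n\}$ and an arc $(i,j)$ if and only if $M(i,j)\neq0$ (self-loops allowed). A strongly connected component (SCC) is an equivalence class of the relation "$i\sim j$ iff there are (possibly length-zero) walks from $i$ to $j$ and from $j$ to $i$". An SCC $W$ is a sink if every arc with initial vertex in $W$ has terminal vertex in $W$. For $A$ row stochastic and $\mathcal{E}$ diagonal nonnegative of the same size, an index $i$ is an anchor of $A-\mathcal{E}$ if $0<\mathcal{E}(i)<2A(i,i)$. $A-\mathcal{E}$ is condensely anchored if every sink SCC of $G[A-\mathcal{E}]$ contains an anchor of $A-\mathcal{E}$. *)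

theory Defs
  imports "HOL-Analysis.Analysis" "Graph_Theory.Digraph_Component"
begin

text \<open>
  A matrix of size \<open>n\<close> is an element of \<^typ>\<open>real ^ 'n ^ 'n\<close>, the index type \<open>'n\<close> standing for
  \<open>{1, \<dots>, n}\<close>; \<open>n > 0\<close> holds because types are nonempty. The diagonal entry written
  \<open>\<E>(i)\<close> is \<open>E $ i $ i\<close>.
\<close>

definition nonnegative_matrix :: "real ^ 'n ^ 'm \<Rightarrow> bool" where
  "nonnegative_matrix M \<longleftrightarrow> (\<forall>i j. 0 \<le> M $ i $ j)"

definition row_stochastic :: "real ^ 'n ^ 'n \<Rightarrow> bool" where
  "row_stochastic M \<longleftrightarrow> nonnegative_matrix M \<and> (\<forall>i. (\<Sum>j\<in>UNIV. M $ i $ j) = 1)"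

definition diagonal_matrix :: "real ^ 'n ^ 'n \<Rightarrow> bool" where
  "diagonal_matrix M \<longleftrightarrow> (\<forall>i j. i \<noteq> j \<longrightarrow> M $ i $ j = 0)"

definition underlying_digraph :: "real ^ 'n ^ 'n \<Rightarrow> ('n, 'n \<times> 'n) pre_digraph" where
  "underlying_digraph M =
     \<lparr>verts = UNIV, arcs = {(i, j). M $ i $ j \<noteq> 0}, tail = fst, head = snd\<rparr>"

text \<open>
  \<^const>\<open>pre_digraph.sccs_verts\<close> consists of the vertex sets of the strongly connected components,
  i.e. of the equivalence classes of mutual reachability (lemma \<open>sccs_verts_conv_scc_of\<close> of the
  imported library); reachability includes walks of length zero.
\<close>

definition sink_sccs :: "('a, 'b) pre_digraph \<Rightarrow> 'a set set" where
  "sink_sccs G =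
     {W \<in> pre_digraph.sccs_verts G. \<forall>e\<in>arcs G. tail G e \<in> W \<longrightarrow> head G e \<in> W}"

text \<open>
  Anchors of \<open>A - E\<close> depend on the pair \<open>(A, E)\<close>, not just on the difference.
\<close>

definition anchor :: "real ^ 'n ^ 'n \<Rightarrow> real ^ 'n ^ 'n \<Rightarrow> 'n \<Rightarrow> bool" where
  "anchor A E i \<longleftrightarrow> 0 < E $ i $ i \<and> E $ i $ i < 2 * A $ i $ i"

definition condensely_anchored :: "real ^ 'n ^ 'n \<Rightarrow> real ^ 'n ^ 'n \<Rightarrow> bool" where
  "condensely_anchored A E \<longleftrightarrow>
     (\<forall>W \<in> sink_sccs (underlying_digraph (A - E)). \<exists>i\<in>W. anchor A E i)"

end

theory Submission
  imports Defs
begin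

text \<open>
  The error \<open>X t - \<sigma>bar\<close> evolves by \<open>B = A - E\<close>. The absolute row sums of \<open>B\<close> are at most \<open>1\<close>,
  with strict inequality exactly at the anchors. Hence the iterates of \<open>\<bar>B\<bar>\<close> on the all-ones
  vector decrease to a fixed point \<open>v\<close> of \<open>\<bar>B\<bar>\<close>. If \<open>v\<close> were nonzero, the indices where it is
  maximal would form a nonempty set closed under the arcs of the digraph and free of anchors; but such
  a set contains a sink component, and therefore an anchor.
\<close>

text \<open>A vertex of \<open>S\<close> that reaches as few vertices as possible lies in a sink
  component: whatever it reaches cannot reach fewer vertices, hence reaches back. Closedness keeps
  this component inside \<open>S\<close>.\<close>

lemma closed_set_contains_sink_scc:
  assumes wf: "wf_digraph G" and fin: "finite (verts G)"
    and "S \<noteq> {}" "S \<subseteq> verts G"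
    and closed: "\<And>e. e \<in> arcs G \<Longrightarrow> tail G e \<in> S \<Longrightarrow> head G e \<in> S"
  obtains W where "W \<in> sink_sccs G" "W \<subseteq> S"
proof -
  interpret wf_digraph G by fact
  define R where "R u = {v. u \<rightarrow>\<^sup>*\<^bsub>G\<^esub> v}" for u
  have finR: "finite (R u)" for u
    using fin by (rule finite_subset[rotated]) (auto simp: R_def reachable_in_verts)
  obtain u where u: "u \<in> S" "\<And>v. v \<in> S \<Longrightarrow> card (R u) \<le> card (R v)"
    using ex_has_least_nat[of "\<lambda>u. u \<in> S" _ "\<lambda>u. card (R u)"] \<open>S \<noteq> {}\<close> by blast
  have RS: "v \<in> S" if "u \<rightarrow>\<^sup>*\<^bsub>G\<^esub> v" for v
    using that
  proof (induction rule: reachable_induct)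
    case base then show ?case using u by simp
  next
    case (step v w)
    then show ?case using closed by (auto simp: arcs_ends_def arc_to_ends_def)
  qed
  have reach_back: "v \<rightarrow>\<^sup>*\<^bsub>G\<^esub> u" if "u \<rightarrow>\<^sup>*\<^bsub>G\<^esub> v" for v
  proof -
    have "R v \<subseteq> R u" using that by (auto simp: R_def intro: reachable_trans)
    \<comment> \<open>\<open>v\<close> lies in \<open>S\<close>, so minimality of
      \<open>card (R u)\<close> turns the inclusion into an equality of finite sets.\<close>
    then have "R v = R u" using u(2)[OF RS[OF that]] finR by (simp add: card_seteq)
    moreover have "u \<in> R u" using u(1) assms(4) by (auto simp: R_def)
    ultimately show ?thesis by (auto simp: R_def)
  qed
  have "scc_of u = R u" by (auto simp: scc_of_def R_def reach_back)
  then have "R u \<in> sccs_verts" using u(1) assms(4) by (auto simp: sccs_verts_conv_scc_of)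
  moreover have "head G e \<in> R u" if "e \<in> arcs G" "tail G e \<in> R u" for e
    using that by (auto simp: R_def intro: reachable_adj_trans in_arcs_imp_in_arcs_ends)
  ultimately have "R u \<in> sink_sccs G" by (auto simp: sink_sccs_def)
  moreover have "R u \<subseteq> S" using RS by (auto simp: R_def)
  ultimately show ?thesis by (rule that)
qed

text \<open>Passing to absolute values of the entries loses nothing here: the row sums of the powers
  of \<bar>B\<bar> already tend to zero, and they dominate \<open>Y\<close> up to the factor
  \<open>norm (Y 0)\<close>.\<close>

lemma substochastic_iterates_tendsto_zero:
  fixes B :: "real ^ 'n ^ 'n" and Y :: "nat \<Rightarrow> real ^ 'n"
  assumes row: "\<And>i. (\<Sum>j\<in>UNIV. \<bar>B $ i $ j\<bar>) \<le> 1"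
    and deficient: "\<And>S. S \<noteq> {} \<Longrightarrow> (\<And>i j. i \<in> S \<Longrightarrow> B $ i $ j \<noteq> 0 \<Longrightarrow> j \<in> S) \<Longrightarrow>
      \<exists>i\<in>S. (\<Sum>j\<in>UNIV. \<bar>B $ i $ j\<bar>) < 1"
    and Y: "\<And>t. Y (Suc t) = B *v Y t"
  shows "Y \<longlonglongrightarrow> 0"
proof -
  \<comment> \<open>\<open>u t i\<close> is the \<open>i\<close>-th row sum of the
    \<open>t\<close>-th power of \<bar>B\<bar>.\<close>
  define u :: "nat \<Rightarrow> 'n \<Rightarrow> real"
    where "u t = ((\<lambda>w i. \<Sum>j\<in>UNIV. \<bar>B $ i $ j\<bar> * w j) ^^ t) (\<lambda>_. 1)" for t
  have u0: "u 0 i = 1" and uS: "u (Suc t) i = (\<Sum>j\<in>UNIV. \<bar>B $ i $ j\<bar> * u t j)" for t i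
    by (simp_all add: u_def)
  have nonneg: "0 \<le> u t i" for t i
    by (induction t arbitrary: i) (auto simp: u0 uS intro!: sum_nonneg)
  \<comment> \<open>The row bound enters only for \<open>t = 0\<close>; afterwards \<bar>B\<bar>
    preserves the entrywise order because its entries are nonnegative.\<close>
  have dec: "u (Suc t) i \<le> u t i" for t i
  proof (induction t arbitrary: i)
    case 0 show ?case using row by (simp add: u0 uS)
  next
    case (Suc t)
    show ?case unfolding uS[of "Suc t"] uS[of t i] by (intro sum_mono mult_left_mono Suc) auto
  qed
  have "\<exists>l. (\<lambda>t. u t i) \<longlonglongrightarrow> l" for i
  proof -
    have "decseq (\<lambda>t. u t i)" by (simp add: decseq_Suc_iff dec)
    from decseq_convergent[OF this, of 0] show ?thesis using nonneg by blast
  qed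
  then obtain v where v: "(\<lambda>t. u t i) \<longlonglongrightarrow> v i" for i by metis
  have v_nonneg: "0 \<le> v i" for i by (rule LIMSEQ_le_const[OF v]) (use nonneg in blast)
  have fixpoint: "v i = (\<Sum>j\<in>UNIV. \<bar>B $ i $ j\<bar> * v j)" for i
  proof (rule LIMSEQ_unique)
    show "(\<lambda>t. u (Suc t) i) \<longlonglongrightarrow> v i" using v by (rule LIMSEQ_Suc)
    show "(\<lambda>t. u (Suc t) i) \<longlonglongrightarrow> (\<Sum>j\<in>UNIV. \<bar>B $ i $ j\<bar> * v j)"
      unfolding uS by (intro tendsto_intros v)
  qed
  define m where "m = Max (range v)"
  have le_m: "v i \<le> m" for i by (simp add: m_def)
  have "m \<le> 0"
  proof (rule ccontr)
    assume "\<not> m \<le> 0"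
    then have "m > 0" by simp
    define S where "S = {i. v i = m}"
    \<comment> \<open>The fixed-point equation at a maximal index, split into two nonnegative terms.
      Both must vanish: the first forces row sum 1, the second forces \<open>v j = m\<close> along
      every arc out of \<open>i\<close>.\<close>
    have gap: "(1 - (\<Sum>j\<in>UNIV. \<bar>B $ i $ j\<bar>)) * m + (\<Sum>j\<in>UNIV. \<bar>B $ i $ j\<bar> * (m - v j)) = 0"
      if "i \<in> S" for i
    proof -
      have "m = (\<Sum>j\<in>UNIV. \<bar>B $ i $ j\<bar> * v j)" using that fixpoint[of i] by (simp add: S_def)
      then show ?thesis
        by (simp add: right_diff_distrib sum_subtractf left_diff_distrib sum_distrib_right)
    qed
    have gap1: "0 \<le> (1 - (\<Sum>j\<in>UNIV. \<bar>B $ i $ j\<bar>)) * m" for i using row[of i] \<open>m > 0\<close> by simp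
    have gap2: "0 \<le> \<bar>B $ i $ j\<bar> * (m - v j)" for i j using le_m[of j] by simp
    have "S \<noteq> {}"
    proof -
      have "m \<in> range v" unfolding m_def by (rule Max_in) auto
      then show ?thesis by (auto simp: S_def)
    qed
    moreover have "j \<in> S" if "i \<in> S" "B $ i $ j \<noteq> 0" for i j
    proof -
      have "(\<Sum>j\<in>UNIV. \<bar>B $ i $ j\<bar> * (m - v j)) = 0"
        using gap[OF that(1)] gap1[of i] sum_nonneg[of UNIV "\<lambda>j. \<bar>B $ i $ j\<bar> * (m - v j)"] gap2
        by (smt (verit))
      then have "\<bar>B $ i $ j\<bar> * (m - v j) = 0" using gap2 by (simp add: sum_nonneg_eq_0_iff)
      then show ?thesis using that(2) by (simp add: S_def)
    qed
    ultimately obtain i where "i \<in> S" "(\<Sum>j\<in>UNIV. \<bar>B $ i $ j\<bar>) < 1" using deficient by blast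
    then have "0 < (1 - (\<Sum>j\<in>UNIV. \<bar>B $ i $ j\<bar>)) * m" using \<open>m > 0\<close> by simp
    moreover have "0 \<le> (\<Sum>j\<in>UNIV. \<bar>B $ i $ j\<bar> * (m - v j))" by (intro sum_nonneg gap2)
    ultimately show False using gap[OF \<open>i \<in> S\<close>] by linarith
  qed
  then have "v i = 0" for i using le_m[of i] v_nonneg[of i] by linarith
  then have u_lim: "(\<lambda>t. u t i) \<longlonglongrightarrow> 0" for i using v[of i] by simp
  have bound: "\<bar>Y t $ i\<bar> \<le> norm (Y 0) * u t i" for t i
  proof (induction t arbitrary: i)
    case 0 show ?case by (simp add: u0 component_le_norm_cart)
  next
    case (Suc t)
    have "\<bar>Y (Suc t) $ i\<bar> \<le> (\<Sum>j\<in>UNIV. \<bar>B $ i $ j\<bar> * \<bar>Y t $ j\<bar>)"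
      unfolding Y matrix_vector_mult_def by (simp flip: abs_mult)
    also have "\<dots> \<le> (\<Sum>j\<in>UNIV. \<bar>B $ i $ j\<bar> * (norm (Y 0) * u t j))"
      by (intro sum_mono mult_left_mono Suc) auto
    also have "\<dots> = norm (Y 0) * u (Suc t) i"
      by (simp add: uS sum_distrib_left algebra_simps)
    finally show ?case .
  qed
  show ?thesis
  proof (rule vec_tendstoI)
    fix i
    have "(\<lambda>t. norm (Y 0) * u t i) \<longlonglongrightarrow> 0" using tendsto_mult_left[OF u_lim] by fastforce
    then show "(\<lambda>t. Y t $ i) \<longlonglongrightarrow> 0 $ i"
      by (simp, rule Lim_null_comparison[rotated]) (simp add: bound)
  qed
qed

text \<open>Off the diagonal \<open>A - E\<close> agrees with the nonnegative \<open>A\<close>, so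
  only the diagonal entry can change the row sum. The resulting value is below 1 exactly when
  \<open>i\<close> is an anchor.\<close>

lemma abs_row_sum_diff_diagonal:
  assumes "row_stochastic A" "diagonal_matrix E"
  shows "(\<Sum>j\<in>UNIV. \<bar>(A - E) $ i $ j\<bar>) = 1 - A $ i $ i + \<bar>A $ i $ i - E $ i $ i\<bar>"
proof -
  have "(\<Sum>j\<in>UNIV. \<bar>(A - E) $ i $ j\<bar>) =
      \<bar>A $ i $ i - E $ i $ i\<bar> + (\<Sum>j\<in>UNIV - {i}. \<bar>(A - E) $ i $ j\<bar>)"
    by (subst sum.remove[of _ i]) auto
  also have "(\<Sum>j\<in>UNIV - {i}. \<bar>(A - E) $ i $ j\<bar>) = (\<Sum>j\<in>UNIV - {i}. A $ i $ j)"
    using assms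
    by (intro sum.cong) (auto simp: diagonal_matrix_def row_stochastic_def nonnegative_matrix_def)
  also have "\<dots> = 1 - A $ i $ i"
    using assms(1) sum.remove[of UNIV i "\<lambda>j. A $ i $ j"] by (simp add: row_stochastic_def)
  finally show ?thesis by simp
qed

theorem corollary2p15:
  fixes A E :: "real ^ 'n ^ 'n"
    and \<sigma> :: real
    and \<sigma>bar X0 :: "real ^ 'n"
    and X :: "nat \<Rightarrow> real ^ 'n"
  assumes "row_stochastic A"
    and "diagonal_matrix E" and "nonnegative_matrix E"
    and "\<And>i. 0 \<le> E $ i $ i \<and> E $ i $ i \<le> 2 * A $ i $ i"
    and "\<sigma>bar = \<sigma> *\<^sub>R 1"
    and "X 0 = X0"
    and "\<And>t. X (Suc t) = A *v X t + E *v (\<sigma>bar - X t)"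
    and "condensely_anchored A E"
  shows "X \<longlonglongrightarrow> \<sigma>bar"
proof -
  note row = abs_row_sum_diff_diagonal[OF assms(1,2)]
  \<comment> \<open>Row sums equal to 1 make constant vectors fixed by \<open>A\<close>, so
    \<open>\<sigma>bar\<close> is an equilibrium and the error recursion is linear.\<close>
  have "A *v \<sigma>bar = \<sigma>bar"
    using assms(1)
    by (simp add: vec_eq_iff assms(5) matrix_vector_mult_def row_stochastic_def flip: sum_distrib_right)
  then have error: "X (Suc t) - \<sigma>bar = (A - E) *v (X t - \<sigma>bar)" for t
    unfolding assms(7)
    by (simp add: matrix_vector_mult_diff_distrib matrix_vector_mult_diff_rdistrib)
  have "(\<lambda>t. X t - \<sigma>bar) \<longlonglongrightarrow> 0"
  proof (rule substochastic_iterates_tendsto_zero[where B = "A - E"])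
    show "(\<Sum>j\<in>UNIV. \<bar>(A - E) $ i $ j\<bar>) \<le> 1" for i
      using assms(4)[of i] unfolding row by linarith
    \<comment> \<open>Closure of \<open>S\<close> under nonzero entries is closure under the arcs of
      \<open>?G\<close>, so \<open>S\<close> contains a sink component and with it an anchor, whose
      row is deficient.\<close>
    fix S assume S: "S \<noteq> {}" "\<And>i j. i \<in> S \<Longrightarrow> (A - E) $ i $ j \<noteq> 0 \<Longrightarrow> j \<in> S"
    let ?G = "underlying_digraph (A - E)"
    have "wf_digraph ?G" by unfold_locales (simp_all add: underlying_digraph_def)
    then obtain W where "W \<in> sink_sccs ?G" "W \<subseteq> S"
      by (rule closed_set_contains_sink_scc[of ?G S]) (use S in \<open>auto simp: underlying_digraph_def\<close>)
    then obtain i where "i \<in> S" "anchor A E i"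
      using assms(8) unfolding condensely_anchored_def by blast
    then show "\<exists>i\<in>S. (\<Sum>j\<in>UNIV. \<bar>(A - E) $ i $ j\<bar>) < 1"
      unfolding row by (intro bexI[of _ i]) (auto simp: anchor_def)
  qed (rule error)
  then show ?thesis by (simp add: LIM_zero_iff)
qed

end
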